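(* Let $T$ be a tree of order $n\geq 4$ with diameter $\operatorname{diam}(T)=3$. Then $$\gamma_t(M(T))= \begin{cases} n-2 & \text{if there are two vertices } v \text{ of } T \text{ with } d_T(v)\ge3,\\ n-1 & \text{otherwise.} \end{cases}$$
   Context: All graphs are finite and simple. $d_T(v)$ denotes the degree of $v$ in $T$, and $\operatorname{diam}(T)$ is the maximum distance between two vertices of $T$. For a graph $H$ with no isolated vertices, a total dominating set of $H$ is a set $S\subseteq V(H)$ such that every vertex of $H$ has at least one neighbor in $S$; $\gamma_t(H)$ is the minimum cardinality of a total dominating set of $H$. The middle graph $M(G)$ of a graph $G$ has vertex set $V(G)\cup E(G)$ (disjoint union), and two of its vertices $x,y$ are adjacent exactly when either $x,y\in E(G)$ are edges of $G$ sharing a common endpoint, or $x\in V(G)$, $y\in E(G)$ and $x$ is an endpoint of $y$ (no two elements of $V(G)$ are adjacent in $M(G)$). *)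

theory Defs
  imports Main
begin

record 'a ugraph =
  verts :: "'a set"
  edges :: "'a set set"

definition simple_graph :: "'a ugraph \<Rightarrow> bool" where
  "simple_graph G \<longleftrightarrow> finite (verts G) \<and> (\<forall>e\<in>edges G. e \<subseteq> verts G \<and> card e = 2)"

(* Irreflexive on a simple graph, since {v, v} has cardinality 1. *)
definition adj :: "'a ugraph \<Rightarrow> 'a \<Rightarrow> 'a \<Rightarrow> bool" where
  "adj G u v \<longleftrightarrow> {u, v} \<in> edges G"

definition degree :: "'a ugraph \<Rightarrow> 'a \<Rightarrow> nat" where
  "degree G v = card {e \<in> edges G. v \<in> e}"

definition walk :: "'a ugraph \<Rightarrow> 'a list \<Rightarrow> bool" where
  "walk G p \<longleftrightarrow> p \<noteq> [] \<and> set p \<subseteq> verts G \<and> successively (adj G) p"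

definition walk_betw :: "'a ugraph \<Rightarrow> 'a \<Rightarrow> 'a list \<Rightarrow> 'a \<Rightarrow> bool" where
  "walk_betw G u p v \<longleftrightarrow> walk G p \<and> hd p = u \<and> last p = v"

definition connected_graph :: "'a ugraph \<Rightarrow> bool" where
  "connected_graph G \<longleftrightarrow>
     verts G \<noteq> {} \<and> (\<forall>u\<in>verts G. \<forall>v\<in>verts G. \<exists>p. walk_betw G u p v)"

(* The first vertex is repeated at the end of the list, so a cycle with k edges is a
   list of length k + 1, and the bound says k >= 3. *)
definition cycle :: "'a ugraph \<Rightarrow> 'a list \<Rightarrow> bool" where
  "cycle G p \<longleftrightarrow> walk G p \<and> 4 \<le> length p \<and> hd p = last p \<and> distinct (tl p)"

definition tree :: "'a ugraph \<Rightarrow> bool" where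
  "tree G \<longleftrightarrow> simple_graph G \<and> connected_graph G \<and> (\<nexists>p. cycle G p)"

(* Meaningful only if some walk joins u and v; its length is its number of edges. *)
definition graph_dist :: "'a ugraph \<Rightarrow> 'a \<Rightarrow> 'a \<Rightarrow> nat" where
  "graph_dist G u v = (LEAST k. \<exists>p. walk_betw G u p v \<and> length p = Suc k)"

(* Meaningful for finite connected graphs. *)
definition diam :: "'a ugraph \<Rightarrow> nat" where
  "diam G = Max {graph_dist G u v | u v. u \<in> verts G \<and> v \<in> verts G}"

definition total_dominating :: "'a ugraph \<Rightarrow> 'a set \<Rightarrow> bool" where
  "total_dominating H S \<longleftrightarrow> S \<subseteq> verts H \<and> (\<forall>v\<in>verts H. \<exists>u\<in>S. adj H v u)"

(* Meaningful for finite graphs without isolated vertices: there the whole vertex set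
   is total dominating, so the minimum is attained. *)
definition total_dom_number :: "'a ugraph \<Rightarrow> nat" where
  "total_dom_number H = (LEAST k. \<exists>S. total_dominating H S \<and> card S = k)"

(* Inl marks the vertices of G and Inr its edges, so the union is disjoint. *)
definition middle_graph :: "'a ugraph \<Rightarrow> ('a + 'a set) ugraph" where
  "middle_graph G =
     \<lparr> verts = verts G <+> edges G,
       edges = {{Inr e, Inr f} | e f. e \<in> edges G \<and> f \<in> edges G \<and> e \<noteq> f \<and> e \<inter> f \<noteq> {}}
             \<union> {{Inl v, Inr e} | v e. v \<in> verts G \<and> e \<in> edges G \<and> v \<in> e} \<rparr>"

lemma verts_middle_graph [simp]: "verts (middle_graph G) = verts G <+> edges G"
  by (simp add: middle_graph_def)

lemma middle_graph_adj [simp]: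
  "\<not> adj (middle_graph G) (Inl u) (Inl v)"
  "adj (middle_graph G) (Inl v) (Inr e) \<longleftrightarrow> v \<in> verts G \<and> e \<in> edges G \<and> v \<in> e"
  "adj (middle_graph G) (Inr e) (Inl v) \<longleftrightarrow> v \<in> verts G \<and> e \<in> edges G \<and> v \<in> e"
  "adj (middle_graph G) (Inr e) (Inr f) \<longleftrightarrow>
     e \<in> edges G \<and> f \<in> edges G \<and> e \<noteq> f \<and> e \<inter> f \<noteq> {}"
  by (auto simp: adj_def middle_graph_def doubleton_eq_iff)

lemma simple_graph_middle_graph:
  assumes "simple_graph G"
  shows "simple_graph (middle_graph G)"
proof -
  have "edges G \<subseteq> Pow (verts G)" and "finite (verts G)"
    using assms by (auto simp: simple_graph_def)
  then have "finite (edges G)"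
    by (meson finite_Pow_iff finite_subset)
  with \<open>finite (verts G)\<close> show ?thesis
    by (force simp: simple_graph_def middle_graph_def card_2_iff doubleton_eq_iff)
qed

lemma middle_graph_no_isolated:
  assumes "simple_graph G" and "\<And>v. v \<in> verts G \<Longrightarrow> \<exists>u. adj G v u"
    and "x \<in> verts (middle_graph G)"
  shows "\<exists>y \<in> verts (middle_graph G). adj (middle_graph G) x y"
proof (cases x)
  case (Inl v)
  then have v: "v \<in> verts G"
    using assms(3) by auto
  then obtain u where "{v, u} \<in> edges G"
    using assms(2) by (auto simp: adj_def)
  then show ?thesis
    using Inl v by (intro bexI[of _ "Inr {v, u}"]) auto
next
  case (Inr e)
  then have e: "e \<in> edges G" "e \<subseteq> verts G" "card e = 2"
    using assms(1,3) by (auto simp: simple_graph_def)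
  then obtain v where "v \<in> e" by fastforce
  then show ?thesis
    using Inr e by (intro bexI[of _ "Inl v"]) auto
qed

end

theory Submission
  imports Defs
begin

text \<open>
  A tree of diameter 3 is a double star: two adjacent centres \<open>a\<close>, \<open>b\<close>, each carrying a nonempty
  set of leaves. A leaf is dominated in the middle graph only by its pendant edge, so all \<open>n - 2\<close>
  pendant edges lie in every total dominating set. They dominate every vertex and the edge \<open>ab\<close>;
  a pendant edge has a neighbour among the others iff its centre has a second leaf. If one centre
  has a single leaf, one more element is needed, and \<open>ab\<close> suffices.
\<close>

section \<open>Walks, shortest walks and unique paths\<close>

lemma adj_commute: "adj G u v \<longleftrightarrow> adj G v u"
  by (simp add: adj_def insert_commute)

lemma simple_graph_adjD:
  assumes "simple_graph G" "adj G u v"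
  shows "u \<in> verts G" "v \<in> verts G" "u \<noteq> v"
  using assms by (force simp: simple_graph_def adj_def)+

lemma walk_Cons_Cons [simp]:
  "walk G (x # y # p) \<longleftrightarrow> x \<in> verts G \<and> adj G x y \<and> walk G (y # p)"
  by (auto simp: walk_def)

lemma walk_singleton [simp]: "walk G [x] \<longleftrightarrow> x \<in> verts G"
  by (auto simp: walk_def)

lemma walk_rev [simp]: "walk G (rev p) \<longleftrightarrow> walk G p"
proof -
  have "successively (\<lambda>x y. adj G y x) p \<longleftrightarrow> successively (adj G) p"
    by (intro successively_cong) (auto simp: adj_commute)
  then show ?thesis
    by (simp add: walk_def)
qed

lemma walk_join: "walk G (p @ x # q) \<longleftrightarrow> walk G (p @ [x]) \<and> walk G (x # q)"
  by (auto simp: walk_def successively_append_iff)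

text \<open>Cutting out the stretch between two visits to the same vertex shortens a walk, so a walk
  attaining the minimum in \<open>graph_dist\<close> repeats no vertex.\<close>

lemma shortest_walk:
  assumes "walk_betw G u p v"
  obtains q where "walk_betw G u q v" "distinct q" "length q = Suc (graph_dist G u v)"
proof -
  \<comment> \<open>Walks are nonempty lists, so the length is some \<open>Suc k\<close> and the
    \<open>LEAST\<close> is attained.\<close>
  have "\<exists>k p. walk_betw G u p v \<and> length p = Suc k"
    using assms by (metis Suc_pred length_greater_0_conv walk_betw_def walk_def)
  then have "\<exists>p. walk_betw G u p v \<and> length p = Suc (graph_dist G u v)"
    unfolding graph_dist_def by (rule LeastI_ex)
  then obtain q where q: "walk_betw G u q v" "length q = Suc (graph_dist G u v)"
    by blast
  have "distinct q"
  proof (rule ccontr)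
    assume "\<not> distinct q"
    then obtain xs y ys zs where eq: "q = xs @ [y] @ ys @ [y] @ zs"
      using not_distinct_decomp by blast
    have "walk G (xs @ y # ys @ y # zs)"
      using q(1) by (simp add: walk_betw_def eq)
    then have "walk G (xs @ [y])" "walk G ((y # ys) @ y # zs)"
      using walk_join[of G xs y "ys @ y # zs"] by auto
    then have "walk G (xs @ y # zs)"
      using walk_join[of G xs y zs] walk_join[of G "y # ys" y zs] by blast
    moreover have "hd (xs @ y # zs) = u" "last (xs @ y # zs) = v"
      using q(1) by (auto simp: walk_betw_def eq hd_append split: if_splits)
    ultimately have "walk_betw G u (xs @ [y] @ zs) v"
      by (simp add: walk_betw_def)
    moreover have "length (xs @ [y] @ zs) = Suc (length xs + length zs)"
      by simp
    ultimately have "graph_dist G u v \<le> length xs + length zs"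
      unfolding graph_dist_def by (intro Least_le) blast
    with q(2) eq show False
      by simp
  qed
  with q that show thesis
    by blast
qed

text \<open>A shared first step is cancelled by induction. If the paths part at \<open>u\<close>,
  following \<open>p\<close> up to its first vertex on \<open>q\<close> and returning to
  \<open>u\<close> along \<open>q\<close> would close a cycle.\<close>

lemma unique_path:
  assumes "\<nexists>c. cycle G c"
    and "walk G (u # p)" "distinct (u # p)" "walk G (u # q)" "distinct (u # q)"
    and "last (u # p) = last (u # q)"
  shows "p = q"
  using assms(2-)
proof (induction p arbitrary: u q)
  case Nil
  then show ?case
    by (cases q rule: rev_cases) auto
next
  case (Cons x p')
  have "q \<noteq> []"
    using Cons.prems(2,5) last_in_set[of "x # p'"] by auto
  then obtain y q' where q: "q = y # q'"
    by (meson neq_Nil_conv)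
  show ?case
  proof (cases "x = y")
    case True
    have "p' = q'"
      by (rule Cons.IH[of x]) (use Cons.prems True in \<open>simp_all add: q\<close>)
    with True q show ?thesis
      by simp
  next
    case False
    \<comment> \<open>The paths end at the same vertex, so they meet after \<open>u\<close>. Taking
      the first such \<open>z\<close> along \<open>x # p'\<close> keeps \<open>s\<close> off
      \<open>q\<close>, which makes the closed walk below free of repetitions apart from
      \<open>u\<close>.\<close>
    have "\<exists>z\<in>set (x # p'). z \<in> set q"
      using Cons.prems \<open>q \<noteq> []\<close> by (metis last_ConsR last_in_set list.distinct(1))
    then obtain s z t where p: "x # p' = s @ z # t" "z \<in> set q" "\<forall>w\<in>set s. w \<notin> set q"
      using split_list_first_prop[of "x # p'" "\<lambda>z. z \<in> set q"] by blast
    then obtain s' t' where q': "q = s' @ z # t'"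
      by (meson split_list)
    have "walk G (u # s @ [z])"
      using Cons.prems(1) walk_join[of G "u # s" z t] by (simp add: p)
    moreover have "walk G (u # s' @ [z])"
      using Cons.prems(3) walk_join[of G "u # s'" z t'] by (simp add: q')
    then have "walk G (z # rev s' @ [u])"
      using walk_rev[of G "u # s' @ [z]"] by simp
    ultimately have "walk G (u # s @ z # rev s' @ [u])"
      using walk_join[of G "u # s" z "rev s' @ [u]"] by (simp only: append_Cons)
    moreover have "distinct (s @ z # rev s' @ [u])"
      using Cons.prems p q' by auto
    \<comment> \<open>Were both empty, \<open>z\<close> would equal both \<open>x\<close> and
      \<open>y\<close>. One more entry raises the length of the closed walk from 3 to the 4 that
      \<open>cycle\<close> demands.\<close>
    moreover have "s \<noteq> [] \<or> s' \<noteq> []"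
      using False p(1) q q' by auto
    then have "4 \<le> length (u # s @ z # rev s' @ [u])"
      by (cases s; cases s') auto
    ultimately have "cycle G (u # s @ z # rev s' @ [u])"
      by (simp add: cycle_def)
    with assms(1) show ?thesis
      by blast
  qed
qed

text \<open>By uniqueness a path is the shortest walk between its ends. This turns a bound on the
  diameter into a bound on the length of every path.\<close>

lemma tree_path_length:
  assumes "tree G" "walk G p" "distinct p"
  shows "length p = Suc (graph_dist G (hd p) (last p))"
proof -
  have "walk_betw G (hd p) p (last p)"
    using assms by (simp add: walk_betw_def)
  then obtain q where q: "walk_betw G (hd p) q (last p)" "distinct q"
      "length q = Suc (graph_dist G (hd p) (last p))"
    by (rule shortest_walk)
  obtain u p' q' where "p = u # p'" "q = u # q'"
    using assms(2) q(1) by (metis list.collapse walk_betw_def walk_def)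
  with unique_path[of G u p' q'] assms q have "p = q"
    by (simp add: tree_def walk_betw_def)
  with q(3) show ?thesis
    by simp
qed

section \<open>Trees of diameter 3 as double stars\<close>

text \<open>\<open>A\<close> and \<open>B\<close> are the leaves at the two centres. They may be
  empty here, so stars are included; diameter 3 brings in \<open>A \<noteq> {}\<close> and
  \<open>B \<noteq> {}\<close> as separate facts.\<close>

definition double_star :: "'a ugraph \<Rightarrow> 'a \<Rightarrow> 'a \<Rightarrow> 'a set \<Rightarrow> 'a set \<Rightarrow> bool" where
  "double_star G a b A B \<longleftrightarrow>
     finite A \<and> finite B \<and> A \<inter> B = {} \<and> a \<noteq> b \<and> {a, b} \<inter> (A \<union> B) = {} \<and>
     verts G = {a, b} \<union> A \<union> B \<and>
     edges G = {{a, b}} \<union> (\<lambda>x. {a, x}) ` A \<union> (\<lambda>x. {b, x}) ` B"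

lemma double_star_commute: "double_star G a b A B \<Longrightarrow> double_star G b a B A"
  by (auto simp: double_star_def insert_commute)

text \<open>The centres are the two inner vertices of a path with three edges. A vertex adjacent to
  neither would lead to a path on five vertices, and an edge between two leaves would close a
  triangle or a 4-cycle.\<close>

lemma tree_diam3_double_star:
  assumes "tree T" "diam T = 3"
  obtains a b A B where "double_star T a b A B" "A \<noteq> {}" "B \<noteq> {}"
proof -
  have simple: "simple_graph T" and conn: "connected_graph T" and acyc: "\<nexists>c. cycle T c"
    using assms(1) by (auto simp: tree_def)
  let ?D = "{graph_dist T u v | u v. u \<in> verts T \<and> v \<in> verts T}"
  have D: "?D = (\<lambda>(u, v). graph_dist T u v) ` (verts T \<times> verts T)"
    by auto
  have fin: "finite ?D"
    using simple unfolding D by (auto simp: simple_graph_def)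
  have ne: "?D \<noteq> {}"
    using conn unfolding connected_graph_def by blast
  \<comment> \<open>The diameter counts edges and \<open>length\<close> counts vertices, hence 4
    rather than 3.\<close>
  have short: "length p \<le> 4" if "walk T p" "distinct p" for p
  proof -
    have "hd p \<in> verts T" "last p \<in> verts T"
      using that(1) by (auto simp: walk_def subset_iff)
    then have "graph_dist T (hd p) (last p) \<le> 3"
      using Max_ge[OF fin] assms(2) by (auto simp: diam_def)
    with tree_path_length[OF assms(1) that] show ?thesis
      by simp
  qed
  obtain u v where "u \<in> verts T" "v \<in> verts T" "graph_dist T u v = 3"
    using Max_in[OF fin ne] assms(2) by (auto simp: diam_def)
  obtain q where "walk T q" "distinct q" "length q = 4"
  proof -
    obtain p where "walk_betw T u p v"
      using conn \<open>u \<in> verts T\<close> \<open>v \<in> verts T\<close> by (auto simp: connected_graph_def)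
    then obtain r where "walk_betw T u r v" "distinct r" "length r = Suc (graph_dist T u v)"
      by (rule shortest_walk)
    with that[of r] \<open>graph_dist T u v = 3\<close> show thesis
      by (simp add: walk_betw_def)
  qed
  then obtain x a b y where q: "walk T [x, a, b, y]" "distinct [x, a, b, y]"
    by (auto simp: eval_nat_numeral length_Suc_conv)
  note adjD = simple_graph_adjD[OF simple]
  have tri: False if "adj T u v" "adj T v w" "adj T w u" for u v w
  proof -
    have "cycle T [u, v, w, u]"
      using that adjD[OF that(1)] adjD[OF that(2)] adjD[OF that(3)] by (simp add: cycle_def)
    with acyc show False
      by blast
  qed
  \<comment> \<open>The two inequalities exclude equal opposite corners; adjacency already separates
    neighbouring ones.\<close>
  have quad: False if "adj T u v" "adj T v w" "adj T w z" "adj T z u" "u \<noteq> w" "v \<noteq> z" for u v w z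
  proof -
    have "cycle T [u, v, w, z, u]"
      using that adjD[OF that(1)] adjD[OF that(2)] adjD[OF that(3)] adjD[OF that(4)]
      by (simp add: cycle_def)
    with acyc show False
      by blast
  qed
  have ab: "adj T a b" "adj T b a"
    using q by (auto simp: adj_commute)
  \<comment> \<open>\<open>C\<close> will be shown closed under adjacency, so that by connectivity
    it is the whole vertex set.\<close>
  define C where "C = {a, b} \<union> {w. adj T a w} \<union> {w. adj T b w}"
  \<comment> \<open>Stated for a generic path \<open>c\<close>, \<open>d\<close>, \<open>y\<close>
    to cover both \<open>a\<close>, \<open>b\<close>, \<open>y\<close> and \<open>b\<close>,
    \<open>a\<close>, \<open>x\<close>. An escape to \<open>z\<close> outside \<open>C\<close> would
    give the path \<open>z\<close>, \<open>w\<close>, \<open>c\<close>, \<open>d\<close>,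
    \<open>y\<close> on five vertices.\<close>
  have closed: "z \<in> C"
    if "adj T c d" "adj T d y" "y \<noteq> c" "C = {c, d} \<union> {w. adj T c w} \<union> {w. adj T d w}"
      "adj T c w" "adj T w z" for c d y w z
  proof (rule ccontr)
    assume z: "z \<notin> C"
    \<comment> \<open>If \<open>w = y\<close>, then \<open>c\<close>, \<open>d\<close>,
      \<open>w\<close> form a triangle; if \<open>w = d\<close>, then \<open>z\<close> is a
      neighbour of \<open>d\<close> and lies in \<open>C\<close>.\<close>
    have "w \<noteq> y" "w \<noteq> d"
      using tri[of c d w] that z by (auto simp: adj_commute)
    then have "distinct [z, w, c, d, y]"
      using that z adjD[OF that(1)] adjD[OF that(2)] adjD[OF that(5)] adjD[OF that(6)] by auto
    moreover have "walk T [z, w, c, d, y]"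
      using that adjD[OF that(2)] adjD[OF that(5)] adjD[OF that(6)] by (auto simp: adj_commute)
    ultimately show False
      using short by fastforce
  qed
  have step: "z \<in> C" if "w \<in> C" "adj T w z" for w z
  proof -
    have "z \<in> C" if "adj T a w"
      using closed[of a b y w z] q that \<open>adj T w z\<close> by (auto simp: C_def)
    moreover have "z \<in> C" if "adj T b w"
      using closed[of b a x w z] q that \<open>adj T w z\<close> by (auto simp: C_def adj_commute)
    ultimately show ?thesis
      using that by (auto simp: C_def)
  qed
  have reach: "last p \<in> C" if "walk T p" "hd p \<in> C" for p
    using that
  proof (induction p rule: induct_list012)
    case (3 w z p)
    then show ?case
      using step[of w z] by auto
  qed (auto simp: walk_def)
  have "a \<in> verts T" "b \<in> verts T"
    using adjD[OF ab(1)] by auto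
  have VC: "verts T = C"
  proof
    show "C \<subseteq> verts T"
      using adjD \<open>a \<in> verts T\<close> \<open>b \<in> verts T\<close> by (auto simp: C_def)
    show "verts T \<subseteq> C"
    proof
      fix w assume "w \<in> verts T"
      then obtain p where "walk_betw T a p w"
        using conn \<open>a \<in> verts T\<close> by (auto simp: connected_graph_def)
      with reach[of p] show "w \<in> C"
        by (auto simp: walk_betw_def C_def)
    qed
  qed
  define A B where "A = {w. adj T a w} - {b}" and "B = {w. adj T b w} - {a}"
  have V: "verts T = {a, b} \<union> A \<union> B"
    by (auto simp: VC C_def A_def B_def)
  \<comment> \<open>Leaves at the same centre would give a triangle, leaves at different centres a
    4-cycle through \<open>a\<close> and \<open>b\<close>.\<close>
  have no_leaf_edge: False if "adj T w z" "w \<in> A \<union> B" "z \<in> A \<union> B" for w z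
    using that tri[of a w z] tri[of b w z] quad[of a w z b] quad[of b w z a] ab
      adjD[OF that(1)]
    by (auto simp: A_def B_def adj_commute)
  have "e \<in> {{a, b}} \<union> (\<lambda>x. {a, x}) ` A \<union> (\<lambda>x. {b, x}) ` B" if "e \<in> edges T" for e
  proof -
    obtain w z where e: "e = {w, z}" "w \<noteq> z"
      using simple \<open>e \<in> edges T\<close> by (auto simp: simple_graph_def card_2_iff)
    then have wz: "adj T w z" "adj T z w"
      using \<open>e \<in> edges T\<close> by (auto simp: adj_def insert_commute)
    have "w \<in> {a, b} \<or> z \<in> {a, b}"
      using no_leaf_edge wz(1) adjD[OF wz(1)] V by blast
    then show ?thesis
      using wz e by (auto simp: A_def B_def image_iff doubleton_eq_iff)
  qed
  moreover have "{a, b} \<in> edges T" "(\<lambda>x. {a, x}) ` A \<subseteq> edges T" "(\<lambda>x. {b, x}) ` B \<subseteq> edges T"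
    using ab by (auto simp: A_def B_def adj_def)
  ultimately have E: "edges T = {{a, b}} \<union> (\<lambda>x. {a, x}) ` A \<union> (\<lambda>x. {b, x}) ` B"
    by blast
  \<comment> \<open>A common neighbour of \<open>a\<close> and \<open>b\<close> would close a
    triangle.\<close>
  have "A \<inter> B = {}"
    using tri[of a b] ab(1) by (auto simp: A_def B_def adj_commute)
  moreover have "{a, b} \<inter> (A \<union> B) = {}"
    using adjD(3) by (auto simp: A_def B_def)
  moreover have "finite A" "finite B"
    using simple V by (auto simp: simple_graph_def)
  ultimately have "double_star T a b A B"
    using V E q(2) by (auto simp: double_star_def)
  moreover have "x \<in> A" "y \<in> B"
    using q by (auto simp: A_def B_def adj_commute)
  ultimately show thesis
    using that by blast
qed

section \<open>Degrees in a double star\<close>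

lemma double_star_degree_centre:
  assumes "double_star G a b A B"
  shows "degree G a = Suc (card A)"
proof -
  have "{e \<in> edges G. a \<in> e} = (\<lambda>x. {a, x}) ` insert b A"
    using assms by (auto simp: double_star_def)
  moreover have "inj_on (\<lambda>x. {a, x}) (insert b A)"
    by (auto simp: inj_on_def doubleton_eq_iff)
  ultimately have "degree G a = card (insert b A)"
    by (simp only: degree_def card_image)
  then show ?thesis
    using assms by (auto simp: double_star_def)
qed

lemma double_star_degree_leaf:
  assumes "double_star G a b A B" "x \<in> A"
  shows "degree G x = 1"
proof -
  have "{e \<in> edges G. x \<in> e} = {{a, x}}"
    using assms by (auto simp: double_star_def)
  then show ?thesis
    by (simp add: degree_def)
qed

text \<open>Leaves have degree 1, so only the centres can reach degree 3. Each centre has one edge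
  to the other centre besides those to its leaves, so degree at least 3 amounts to at least two
  leaves.\<close>

lemma double_star_two_large_degrees:
  assumes ds: "double_star G a b A B"
  shows "(\<exists>u\<in>verts G. \<exists>v\<in>verts G. u \<noteq> v \<and> degree G u \<ge> 3 \<and> degree G v \<ge> 3) \<longleftrightarrow>
    card A \<ge> 2 \<and> card B \<ge> 2" (is "?L \<longleftrightarrow> _")
proof -
  note ds' = double_star_commute[OF ds]
  have "u \<in> {a, b}" if "u \<in> verts G" "degree G u \<ge> 3" for u
    using that ds double_star_degree_leaf[OF ds] double_star_degree_leaf[OF ds']
    by (fastforce simp: double_star_def)
  moreover have "a \<in> verts G" "b \<in> verts G" "a \<noteq> b"
    using ds by (auto simp: double_star_def)
  ultimately have "?L \<longleftrightarrow> degree G a \<ge> 3 \<and> degree G b \<ge> 3"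
    by blast
  then show ?thesis
    using double_star_degree_centre[OF ds] double_star_degree_centre[OF ds'] by auto
qed

section \<open>Total dominating sets of the middle graph\<close>

text \<open>Adjacency to an edge in the middle graph means lying on it or meeting it, so total
  domination by edges alone becomes a condition on \<open>G\<close>. The dominating sets exhibited
  below all have this form.\<close>

lemma total_dominating_edges_iff:
  "total_dominating (middle_graph G) (Inr ` F) \<longleftrightarrow>
    F \<subseteq> edges G \<and> (\<forall>v\<in>verts G. \<exists>f\<in>F. v \<in> f) \<and>
    (\<forall>e\<in>edges G. \<exists>f\<in>F. e \<noteq> f \<and> e \<inter> f \<noteq> {})"
proof -
  let ?M = "middle_graph G"
  have sub: "Inr ` F \<subseteq> verts ?M \<longleftrightarrow> F \<subseteq> edges G"
    by auto
  have "(\<forall>x\<in>verts ?M. \<exists>u\<in>Inr ` F. adj ?M x u) \<longleftrightarrow>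
      (\<forall>v\<in>verts G. \<exists>f\<in>F. adj ?M (Inl v) (Inr f)) \<and>
      (\<forall>e\<in>edges G. \<exists>f\<in>F. adj ?M (Inr e) (Inr f))"
    by (simp add: Plus_def ball_Un del: middle_graph_adj)
  \<comment> \<open>The adjacencies also demand \<open>f \<in> edges G\<close>, which follows once
    \<open>F \<subseteq> edges G\<close>; hence a conditional equivalence, which
    \<open>conj_cong\<close> then absorbs.\<close>
  also have "\<dots> \<longleftrightarrow> (\<forall>v\<in>verts G. \<exists>f\<in>F. v \<in> f) \<and>
      (\<forall>e\<in>edges G. \<exists>f\<in>F. e \<noteq> f \<and> e \<inter> f \<noteq> {})" if "F \<subseteq> edges G"
    using that by (simp add: subset_iff cong: bex_cong)
  finally show ?thesis
    unfolding total_dominating_def sub by (rule conj_cong[OF refl])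
qed

definition pendant_edges :: "'a \<Rightarrow> 'a \<Rightarrow> 'a set \<Rightarrow> 'a set \<Rightarrow> 'a set set" where
  "pendant_edges a b A B = (\<lambda>x. {a, x}) ` A \<union> (\<lambda>x. {b, x}) ` B"

lemma pendant_edges_commute: "pendant_edges a b A B = pendant_edges b a B A"
  by (auto simp: pendant_edges_def)

lemma card_pendant_edges:
  assumes "double_star G a b A B"
  shows "finite (pendant_edges a b A B)" "card (pendant_edges a b A B) = card (verts G) - 2"
proof -
  show "finite (pendant_edges a b A B)"
    using assms by (simp add: double_star_def pendant_edges_def)
  have "card (pendant_edges a b A B) = card ((\<lambda>x. {a, x}) ` A) + card ((\<lambda>x. {b, x}) ` B)"
    unfolding pendant_edges_def using assms
    by (intro card_Un_disjoint) (auto simp: double_star_def doubleton_eq_iff)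
  also have "\<dots> = card A + card B"
    by (simp add: card_image inj_on_def doubleton_eq_iff)
  also have "\<dots> = card (A \<union> B)"
    using assms by (simp add: double_star_def card_Un_disjoint)
  also have "A \<union> B = verts G - {a, b}"
    using assms by (auto simp: double_star_def)
  also have "card \<dots> = card (verts G) - 2"
    using assms by (subst card_Diff_subset) (auto simp: double_star_def)
  finally show "card (pendant_edges a b A B) = card (verts G) - 2" .
qed

text \<open>A leaf lies on a single edge, and that edge is its only neighbour in the middle
  graph.\<close>

lemma pendant_edges_in_total_dominating:
  assumes ds: "double_star G a b A B" and S: "total_dominating (middle_graph G) S"
  shows "Inr ` pendant_edges a b A B \<subseteq> S"
proof -
  \<comment> \<open>The centres and leaf sets are bound afresh, so that the fact serves both sides
    through \<open>double_star_commute\<close>.\<close>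
  have "Inr {a, x} \<in> S" if "double_star G a b A B" "x \<in> A" for a b A B x
  proof -
    have "x \<in> verts G"
      using that by (auto simp: double_star_def)
    then obtain s where "s \<in> S" "adj (middle_graph G) (Inl x) s"
      using S by (auto simp: total_dominating_def)
    then obtain e where "Inr e \<in> S" "e \<in> edges G" "x \<in> e"
      by (cases s) auto
    moreover have "e = {a, x}"
      using that calculation by (auto simp: double_star_def)
    ultimately show ?thesis
      by simp
  qed
  from this[OF ds] this[OF double_star_commute[OF ds]] show ?thesis
    by (auto simp: pendant_edges_def)
qed

text \<open>Every edge passes through a centre, and with two leaves at that centre some pendant edge
  there differs from the given edge.\<close>

lemma pendant_edges_total_dominating:
  assumes ds: "double_star G a b A B" and "card A \<ge> 2" "card B \<ge> 2"
  shows "total_dominating (middle_graph G) (Inr ` pendant_edges a b A B)"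
proof -
  have dom: "\<exists>f\<in>pendant_edges a b A B. f \<noteq> e \<and> c \<in> f"
    if "c \<in> {a, b}" for c e
  proof -
    have "\<exists>f\<in>pendant_edges a b A B. f \<noteq> e \<and> a \<in> f" if card: "card A \<ge> 2" for a b A B
    proof -
      obtain X where "X \<subseteq> A" "card X = 2"
        using obtain_subset_with_card_n[OF card] by blast
      then obtain x y where "x \<in> A" "y \<in> A" "x \<noteq> y"
        by (auto simp: card_2_iff)
      then have "{a, x} \<in> pendant_edges a b A B" "{a, y} \<in> pendant_edges a b A B" "{a, x} \<noteq> {a, y}"
        by (auto simp: pendant_edges_def doubleton_eq_iff)
      then show ?thesis
        by (metis insertI1)
    qed
    from this[of A a b B] this[of B b a A] show ?thesis
      using that assms by (auto simp: pendant_edges_commute)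
  qed
  have sub: "pendant_edges a b A B \<subseteq> edges G"
    using ds by (auto simp: double_star_def pendant_edges_def)
  \<comment> \<open>With \<open>e = {}\<close> the fact \<open>dom\<close> just supplies a pendant
    edge at a centre; a leaf lies on its own.\<close>
  have "\<exists>f\<in>pendant_edges a b A B. v \<in> f" if "v \<in> verts G" for v
    using that ds dom[of v "{}"] by (auto simp: double_star_def pendant_edges_def)
  moreover have "\<exists>f\<in>pendant_edges a b A B. e \<noteq> f \<and> e \<inter> f \<noteq> {}" if "e \<in> edges G" for e
  proof -
    have "\<exists>c\<in>{a, b}. c \<in> e"
      using that ds by (auto simp: double_star_def)
    with dom[of _ e] show ?thesis
      by blast
  qed
  ultimately show ?thesis
    using sub by (simp add: total_dominating_edges_iff)
qed

text \<open>The central edge meets every pendant edge and is itself met by a pendant edge at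
  \<open>a\<close>.\<close>

lemma all_edges_total_dominating:
  assumes ds: "double_star G a b A B" and ne: "A \<noteq> {}"
  shows "total_dominating (middle_graph G) (Inr ` edges G)"
proof -
  have E: "edges G = {{a, b}} \<union> (\<lambda>x. {a, x}) ` A \<union> (\<lambda>x. {b, x}) ` B"
    and V: "verts G = {a, b} \<union> A \<union> B" and b: "b \<notin> A"
    using ds by (auto simp: double_star_def)
  have "\<exists>f\<in>edges G. v \<in> f" if "v \<in> verts G" for v
    using that unfolding E V by blast
  moreover have "\<exists>f\<in>edges G. e \<noteq> f \<and> e \<inter> f \<noteq> {}" if "e \<in> edges G" for e
  proof (cases "e = {a, b}")
    case True
    obtain x where "x \<in> A"
      using ne by blast
    then have "{a, x} \<in> edges G" "{a, b} \<noteq> {a, x}"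
      using b by (auto simp: E doubleton_eq_iff)
    with True show ?thesis
      by (intro bexI[of _ "{a, x}"]) auto
  next
    case False
    have "a \<in> e \<or> b \<in> e"
      using that by (auto simp: E)
    moreover have "{a, b} \<in> edges G"
      by (simp add: E)
    ultimately show ?thesis
      using False by (intro bexI[of _ "{a, b}"]) auto
  qed
  ultimately show ?thesis
    by (simp add: total_dominating_edges_iff)
qed

text \<open>If \<open>x\<close> is the sole leaf at \<open>a\<close>, the only other edge meeting
  \<open>{a, x}\<close> is the central one, which is not pendant.\<close>

lemma pendant_edges_not_total_dominating:
  assumes ds: "double_star G a b A B" and "card A = 1"
  shows "\<not> total_dominating (middle_graph G) (Inr ` pendant_edges a b A B)"
proof
  assume S: "total_dominating (middle_graph G) (Inr ` pendant_edges a b A B)"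
  obtain x where A: "A = {x}"
    using assms(2) by (meson card_1_singletonE)
  then have "{a, x} \<in> edges G"
    using ds by (auto simp: double_star_def)
  moreover have "\<forall>e\<in>edges G. \<exists>f\<in>pendant_edges a b A B. e \<noteq> f \<and> e \<inter> f \<noteq> {}"
    using S by (simp add: total_dominating_edges_iff)
  ultimately obtain f where "f \<in> pendant_edges a b A B" "{a, x} \<noteq> f" "{a, x} \<inter> f \<noteq> {}"
    by meson
  then show False
    using ds by (auto simp: double_star_def pendant_edges_def A)
qed

section \<open>The total domination number\<close>

lemma total_dom_numberI:
  assumes "total_dominating H S" "\<And>S'. total_dominating H S' \<Longrightarrow> card S \<le> card S'"
  shows "total_dom_number H = card S"
  unfolding total_dom_number_def using assms by (intro Least_equality) auto

theorem theorem3p3: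
  fixes T :: "'a ugraph" and n :: nat
  assumes "tree T"
    and "card (verts T) = n"
    and "n \<ge> 4"
    and "diam T = 3"
  shows "total_dom_number (middle_graph T) =
    (if \<exists>u\<in>verts T. \<exists>v\<in>verts T. u \<noteq> v \<and> degree T u \<ge> 3 \<and> degree T v \<ge> 3
     then n - 2 else n - 1)"
proof -
  obtain a b A B where ds: "double_star T a b A B" and ne: "A \<noteq> {}" "B \<noteq> {}"
    using tree_diam3_double_star assms by blast
  define P where "P = pendant_edges a b A B"
  have P: "finite P" "card P = n - 2"
    using card_pendant_edges[OF ds] assms(2) by (auto simp: P_def)
  then have cP: "card (Inr ` P :: ('a + 'a set) set) = n - 2"
    by (simp add: card_image)
  \<comment> \<open>Infinite sets have \<open>card\<close> 0, so lower bounds on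
    \<open>card S\<close> depend on finiteness.\<close>
  have fin: "finite S" if "total_dominating (middle_graph T) S" for S
  proof -
    have "finite (verts (middle_graph T))"
      using ds by (auto simp: double_star_def)
    with that show ?thesis
      by (auto simp: total_dominating_def intro: finite_subset)
  qed
  have sub: "Inr ` P \<subseteq> S" if "total_dominating (middle_graph T) S" for S
    using pendant_edges_in_total_dominating[OF ds that] by (simp add: P_def)
  show ?thesis
  proof (cases "card A \<ge> 2 \<and> card B \<ge> 2")
    case True
    have "total_dom_number (middle_graph T) = card (Inr ` P :: ('a + 'a set) set)"
      using pendant_edges_total_dominating[OF ds] True fin sub
      by (intro total_dom_numberI) (simp_all add: P_def card_mono)
    with True cP show ?thesis
      by (simp add: double_star_two_large_degrees[OF ds])
  next
    case False
    \<comment> \<open>Both leaf sets are nonempty, so in this case some centre has exactly one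
      leaf.\<close>
    have "card A \<noteq> 0" "card B \<noteq> 0"
      using ds ne by (auto simp: double_star_def)
    with False have "card A = 1 \<or> card B = 1"
      by linarith
    then have not_dom: "\<not> total_dominating (middle_graph T) (Inr ` P)"
      using pendant_edges_not_total_dominating[OF ds]
        pendant_edges_not_total_dominating[OF double_star_commute[OF ds]]
      by (auto simp: P_def pendant_edges_commute[of b a])
    have "edges T = insert {a, b} P" "{a, b} \<notin> P"
      using ds by (auto simp: double_star_def P_def pendant_edges_def doubleton_eq_iff)
    \<comment> \<open>The central edge adds one to \<open>n - 2\<close>; the bound on
      \<open>n\<close> keeps truncated subtraction harmless.\<close>
    then have "card (edges T) = n - 1"
      using P assms(3) by simp
    then have cE: "card (Inr ` edges T :: ('a + 'a set) set) = n - 1"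
      by (simp add: card_image)
    \<comment> \<open>\<open>S\<close> contains \<open>P\<close> and cannot equal it, so it has more
      than \<open>n - 2\<close> elements.\<close>
    have "n - 1 \<le> card S" if S: "total_dominating (middle_graph T) S" for S
    proof -
      have "Inr ` P \<subset> S"
        using sub[OF S] S not_dom by auto
      then have "card (Inr ` P :: ('a + 'a set) set) < card S"
        using fin[OF S] by (rule psubset_card_mono[rotated])
      with cP show ?thesis
        by simp
    qed
    then have "total_dom_number (middle_graph T) = card (Inr ` edges T :: ('a + 'a set) set)"
      using all_edges_total_dominating[OF ds ne(1)] cE by (intro total_dom_numberI) auto
    with cE have "total_dom_number (middle_graph T) = n - 1"
      by simp
    then show ?thesis
      unfolding double_star_two_large_degrees[OF ds] if_not_P[OF False] .
  qed
qed

end
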